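(* Let $\mathcal X\subset\mathbb R$ be a nontrivial interval, let $r,k$ be positive integers, let $\mathcal F$ be a subset of $\mathcal F_{r,k}$ and let $\overline f\in\mathcal F$ be a piecewise polynomial function with degree at most $r-1$ based on a partition of $\mathcal X$ into at most $K\ge1$ nontrivial intervals (that is, on each interval of the partition $\overline f$ coincides with a polynomial of degree at most $r-1$). Then $\overline f$ is extremal in $\mathcal F$ with degree at most $(r+1)k+r(K-1)$.
   Context: A nontrivial interval is an interval of $\mathbb R$ with positive length. $r$-monotonicity. Let $I$ be a nontrivial interval and $r\ge1$ an integer. For $\mathbf v=(v_0,\ldots,v_r)\in I^{r+1}$ and $f:I\to\mathbb R$, let $L_{\mathbf v}(f)$ be the determinant of the $(r+1)\times(r+1)$ matrix whose row of index $i\in\{0,\ldots,r\}$ is $(1,v_i,\ldots,v_i^{r-1},f(v_i))$. The function $f$ is $r$-nondecreasing on $I$ if $L_{\mathbf v}(f)\ge0$ for all $v_0<\ldots<v_r$ in $I$, $r$-nonincreasing if $-f$ is $r$-nondecreasing, and $r$-monotone if it is one or the other. (For $r=1$ this is monotonicity; for $r=2$ it means convex or concave.) $\mathcal F_{r,k}$ is the class of functions on $\mathcal X$ which are $r$-monotone on each element of some partition (depending on the function) of $\mathcal X$ into at most $k$ nontrivial intervals. VC-dimension. The VC-dimension of a class $\mathcal A$ of subsets of a set $\mathcal Y$ is not larger than $D$ if $|\{B\cap A: A\in\mathcal A\}|<2^{|B|}$ for every finite $B\subset\mathcal Y$ with $|B|>D$. Extremal elements. $\overline f\in\mathcal F$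 is extremal in $\mathcal F$ with degree not larger than $D\ge1$ if the classes of subsets $\{\{f>\overline f\}: f\in\mathcal F\}$ and $\{\{f<\overline f\}: f\in\mathcal F\}$ of $\mathcal X$ both have VC-dimension not larger than $D$. *)

theory Defs
  imports
    "HOL-Analysis.Topology_Euclidean_Space"
    "HOL-Library.Disjoint_Sets"
    "HOL-Computational_Algebra.Polynomial"
    "Jordan_Normal_Form.Determinant"
begin

definition nontrivial_interval :: "real set \<Rightarrow> bool" where
  "nontrivial_interval I \<longleftrightarrow> is_interval I \<and> (\<exists>a\<in>I. \<exists>b\<in>I. a < b)"

(* Functions on a subset X of the reals are represented by total functions real => real;
   all notions below depend only on their values on X. *)

definition L_mat :: "nat \<Rightarrow> (nat \<Rightarrow> real) \<Rightarrow> (real \<Rightarrow> real) \<Rightarrow> real mat" where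
  "L_mat r v f = mat (r + 1) (r + 1) (\<lambda>(i, j). if j < r then v i ^ j else f (v i))"

definition L_det :: "nat \<Rightarrow> (nat \<Rightarrow> real) \<Rightarrow> (real \<Rightarrow> real) \<Rightarrow> real" where
  "L_det r v f = det (L_mat r v f)"

definition r_nondecreasing_on :: "nat \<Rightarrow> real set \<Rightarrow> (real \<Rightarrow> real) \<Rightarrow> bool" where
  "r_nondecreasing_on r I f \<longleftrightarrow>
     (\<forall>v :: nat \<Rightarrow> real. (\<forall>i\<le>r. v i \<in> I) \<and> strict_mono_on {..r} v \<longrightarrow> L_det r v f \<ge> 0)"

definition r_nonincreasing_on :: "nat \<Rightarrow> real set \<Rightarrow> (real \<Rightarrow> real) \<Rightarrow> bool" where
  "r_nonincreasing_on r I f \<longleftrightarrow> r_nondecreasing_on r I (\<lambda>x. - f x)"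

definition r_monotone_on :: "nat \<Rightarrow> real set \<Rightarrow> (real \<Rightarrow> real) \<Rightarrow> bool" where
  "r_monotone_on r I f \<longleftrightarrow> r_nondecreasing_on r I f \<or> r_nonincreasing_on r I f"

definition interval_partition :: "real set \<Rightarrow> nat \<Rightarrow> real set set \<Rightarrow> bool" where
  "interval_partition X n P \<longleftrightarrow>
     partition_on X P \<and> finite P \<and> card P \<le> n \<and> (\<forall>I\<in>P. nontrivial_interval I)"

definition piecewise_r_monotone :: "real set \<Rightarrow> nat \<Rightarrow> nat \<Rightarrow> (real \<Rightarrow> real) set" where
  "piecewise_r_monotone X r k =
     {f. \<exists>P. interval_partition X k P \<and> (\<forall>I\<in>P. r_monotone_on r I f)}"

definition piecewise_polynomial :: "real set \<Rightarrow> nat \<Rightarrow> nat \<Rightarrow> (real \<Rightarrow> real) \<Rightarrow> bool" where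
  "piecewise_polynomial X d K f \<longleftrightarrow>
     (\<exists>P. interval_partition X K P \<and>
          (\<forall>I\<in>P. \<exists>p :: real poly. degree p \<le> d \<and> (\<forall>x\<in>I. f x = poly p x)))"

definition VC_dim_le :: "'a set \<Rightarrow> 'a set set \<Rightarrow> nat \<Rightarrow> bool" where
  "VC_dim_le Y \<A> D \<longleftrightarrow>
     (\<forall>B. finite B \<and> B \<subseteq> Y \<and> card B > D \<longrightarrow> card {B \<inter> A | A. A \<in> \<A>} < 2 ^ card B)"

definition extremal :: "'a set \<Rightarrow> ('a \<Rightarrow> real) set \<Rightarrow> ('a \<Rightarrow> real) \<Rightarrow> nat \<Rightarrow> bool" where
  "extremal X F f0 D \<longleftrightarrow>
     f0 \<in> F \<and> D \<ge> 1 \<and>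
     VC_dim_le X {{x \<in> X. f x > f0 x} | f. f \<in> F} D \<and>
     VC_dim_le X {{x \<in> X. f x < f0 x} | f. f \<in> F} D"

end

theory Submission
  imports Defs
begin

text \<open>
  Suppose that the sets \<open>{f > f0}\<close> shatter a large finite set of points. We select an
  \<open>f\<close> whose sign pattern relative to \<open>f0\<close> alternates inside each piece of
  \<open>f0\<close> and is multiplied by \<open>(-1) ^ (r + 1)\<close> when passing to another piece.
  Expanding \<open>L_det r v f\<close> along its last column shows that \<open>r + 1\<close> consecutive
  points lying in a single piece of \<open>f0\<close> and a single piece \<open>I\<close> of \<open>f\<close>
  must end with the sign given by the direction of monotonicity of \<open>f\<close> on \<open>I\<close>.
  Hence no common piece contains \<open>r + 2\<close> points; and, by the choice of the pattern, between
  two common pieces in \<open>I\<close> with \<open>r + 1\<close> points there is one with at most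
  \<open>r - 1\<close> points. So \<open>I\<close> contains at most \<open>r j + 1\<close> points if it meets
  \<open>j\<close> pieces of \<open>f0\<close>, and one sums over \<open>I\<close>.
\<close>

section \<open>Vandermonde determinants and the sign of \<open>L_det\<close>\<close>

definition vandermonde :: "nat \<Rightarrow> (nat \<Rightarrow> real) \<Rightarrow> real" where
  "vandermonde n v = det (mat n n (\<lambda>(i, j). v i ^ j))"

definition skip :: "nat \<Rightarrow> nat \<Rightarrow> nat" where
  "skip i j = (if j < i then j else Suc j)"

lemma L_det_expand:
  "L_det r v f = (\<Sum>i\<le>r. (-1) ^ (i + r) * f (v i) * vandermonde r (v \<circ> skip i))"
proof -
  have "L_det r v f = (\<Sum>i<Suc r. L_mat r v f $$ (i, r) * cofactor (L_mat r v f) i r)"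
    unfolding L_det_def by (rule laplace_expansion_column) (auto simp: L_mat_def)
  also have "\<dots> = (\<Sum>i<Suc r. (-1) ^ (i + r) * f (v i) * vandermonde r (v \<circ> skip i))"
  proof (rule sum.cong[OF refl])
    fix i assume i: "i \<in> {..<Suc r}"
    have "mat_delete (L_mat r v f) i r = mat r r (\<lambda>(i', j). (v \<circ> skip i) i' ^ j)"
      using i by (intro eq_matI) (auto simp: mat_delete_def L_mat_def skip_def)
    then show "L_mat r v f $$ (i, r) * cofactor (L_mat r v f) i r
        = (-1) ^ (i + r) * f (v i) * vandermonde r (v \<circ> skip i)"
      using i by (simp add: cofactor_def vandermonde_def L_mat_def)
  qed
  finally show ?thesis by (simp add: lessThan_Suc_atMost)
qed

lemma L_det_add: "L_det r v (\<lambda>x. f x + g x) = L_det r v f + L_det r v g"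
  by (simp add: L_det_expand sum.distrib algebra_simps)

lemma L_det_cmult: "L_det r v (\<lambda>x. c * f x) = c * L_det r v f"
  by (simp add: L_det_expand sum_distrib_left algebra_simps)

lemma L_det_uminus: "L_det r v (\<lambda>x. - f x) = - L_det r v f"
  using L_det_cmult[of r v "-1" f] by simp

lemma L_det_sum: "L_det r v (\<lambda>x. \<Sum>j\<in>A. f j x) = (\<Sum>j\<in>A. L_det r v (f j))"
proof (induction A rule: infinite_finite_induct)
  case (insert a A)
  then show ?case by (simp add: L_det_add)
qed (simp_all add: L_det_expand)

lemma L_det_monomial: "j < r \<Longrightarrow> L_det r v (\<lambda>x. x ^ j) = 0"
  unfolding L_det_def
  by (rule det_identical_columns[of _ "r + 1" j r]) (auto simp: L_mat_def col_def)

text \<open>By linearity in \<open>f\<close> it suffices to treat monomials, for which the last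
  column repeats an earlier one.\<close>

lemma L_det_poly:
  assumes "degree p < r"
  shows "L_det r v (poly p) = 0"
proof -
  have "L_det r v (poly p) = L_det r v (\<lambda>x. \<Sum>j\<le>degree p. coeff p j * x ^ j)"
    by (intro arg_cong[where f = "L_det r v"] ext) (rule poly_altdef)
  also have "\<dots> = 0"
    using assms by (simp add: L_det_sum L_det_cmult L_det_monomial)
  finally show ?thesis .
qed

text \<open>Adding lower monomials to the last column does not change the determinant, so that
  column may hold the values of the monic \<open>q\<close> vanishing at \<open>v 0\<close>, ...,
  \<open>v (n - 1)\<close>. Expansion then leaves a single term.\<close>

lemma vandermonde_Suc: "vandermonde (Suc n) v = (\<Prod>i<n. v n - v i) * vandermonde n v"
proof -
  define q where "q = (\<Prod>i<n. [:- v i, 1:])"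
  have lead: "lead_coeff q = 1"
    unfolding q_def lead_coeff_prod by simp
  have deg: "degree q = n"
    by (simp add: q_def degree_prod_eq_sum_degree)
  have q: "poly q x = (\<Prod>i<n. x - v i)" for x
    by (simp add: q_def poly_prod)
  have "poly q x = (\<Sum>j<n. coeff q j * x ^ j) + x ^ n" for x
    using lead by (simp add: poly_altdef deg lessThan_Suc_atMost[symmetric])
  then have "L_det n v (poly q) = L_det n v (\<lambda>x. (\<Sum>j<n. coeff q j * x ^ j) + x ^ n)"
    by presburger
  also have "\<dots> = L_det n v (\<lambda>x. x ^ n)"
    by (simp add: L_det_add L_det_sum L_det_cmult L_det_monomial)
  also have "\<dots> = vandermonde (Suc n) v"
    unfolding L_det_def vandermonde_def L_mat_def
    by (intro arg_cong[where f = det] eq_matI) (auto simp: less_Suc_eq)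
  finally have "vandermonde (Suc n) v = L_det n v (poly q)" ..
  also have "\<dots> = (\<Sum>i\<in>{n}. (-1) ^ (i + n) * poly q (v i) * vandermonde n (v \<circ> skip i))"
    unfolding L_det_expand by (rule sum.mono_neutral_right) (auto simp: q)
  also have "\<dots> = (\<Prod>i<n. v n - v i) * vandermonde n (v \<circ> skip n)"
    by (simp add: q flip: mult_2)
  also have "vandermonde n (v \<circ> skip n) = vandermonde n v"
    unfolding vandermonde_def by (intro arg_cong[where f = det] eq_matI) (auto simp: skip_def)
  finally show ?thesis .
qed

lemma vandermonde_pos: "strict_mono_on {..<n} v \<Longrightarrow> vandermonde n v > 0"
proof (induction n)
  case 0
  then show ?case by (simp add: vandermonde_def)
next
  case (Suc n)
  have "strict_mono_on {..<n} v"
    using Suc.prems by (auto simp: strict_mono_on_def)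
  moreover have "v i < v n" if "i < n" for i
    using Suc.prems that by (auto simp: strict_mono_on_def)
  ultimately show ?case
    using Suc.IH by (auto simp: vandermonde_Suc intro!: mult_pos_pos prod_pos)
qed

text \<open>Subtracting \<open>p\<close> leaves \<open>L_det\<close> unchanged. In the expansion of
  \<open>f - p\<close> the cofactor signs then match the sign pattern, so no term cancels another.
  The sign prescribed at the last point \<open>v r\<close> is \<open>\<sigma>\<close>
  itself.\<close>

lemma L_det_alternating:
  assumes r: "r \<ge> 1" and v: "strict_mono_on {..r} v"
    and p: "degree p < r"
    and \<sigma>: "\<sigma> \<in> {1, -1}"
    and pos: "\<And>i. i \<le> r \<Longrightarrow> (f (v i) > poly p (v i)) = ((-1) ^ (i + r) * \<sigma> = (1 :: real))"
  shows "\<sigma> * L_det r v f > 0"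
proof -
  define g where "g x = f x - poly p x" for x
  let ?t = "\<lambda>i. \<sigma> * ((-1) ^ (i + r) * g (v i) * vandermonde r (v \<circ> skip i))"
  have V: "vandermonde r (v \<circ> skip i) > 0" if "i \<le> r" for i
    using v that by (intro vandermonde_pos) (auto simp: strict_mono_on_def skip_def)
  have eps: "(-1) ^ (i + r) * \<sigma> \<in> {1, -1}" for i
    using \<sigma> by (cases "even (i + r)") auto
  have t: "?t i = ((-1) ^ (i + r) * \<sigma>) * (g (v i) * vandermonde r (v \<circ> skip i))" for i
    by simp
  have nonneg: "?t i \<ge> 0" if "i \<le> r" for i
  proof (cases "(-1) ^ (i + r) * \<sigma> = 1")
    case True
    then have "g (v i) > 0" using pos[OF that] by (simp add: g_def)
    then show ?thesis unfolding t True using V[OF that] by simp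
  next
    case False
    then have eq: "(-1) ^ (i + r) * \<sigma> = -1" using eps[of i] by auto
    have "g (v i) \<le> 0" using pos[OF that] False by (simp add: g_def)
    then show ?thesis unfolding t eq using V[OF that] by (simp add: mult_nonpos_nonneg)
  qed
  have strict: "?t i > 0" if "i \<le> r" "(-1) ^ (i + r) * \<sigma> = 1" for i
  proof -
    have "g (v i) > 0" using pos that by (simp add: g_def)
    then show ?thesis unfolding t that(2) using V[OF that(1)] by simp
  qed
  \<comment> \<open>Points with \<open>f\<close> not above \<open>p\<close> may satisfy
    \<open>f = p\<close> and contribute zero. Strictness comes from a point with
    \<open>f > p\<close>, found among the last two indices.\<close>
  have "\<exists>i\<le>r. (-1) ^ (i + r) * \<sigma> = 1"
  proof (cases "\<sigma> = 1")
    case True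
    then show ?thesis by (intro exI[of _ r]) (simp flip: mult_2)
  next
    case False
    then have "(-1) ^ (r - 1 + r) * \<sigma> = 1"
      using \<sigma> r by (cases r) auto
    then show ?thesis by (intro exI[of _ "r - 1"]) simp
  qed
  then obtain i where "i \<le> r" "?t i > 0" using strict by blast
  then have "0 < (\<Sum>i\<le>r. ?t i)"
    using nonneg by (intro sum_pos2[of _ i]) auto
  also have "\<dots> = \<sigma> * L_det r v g"
    by (simp add: L_det_expand sum_distrib_left)
  also have "L_det r v g = L_det r v g + L_det r v (poly p)"
    using L_det_poly[OF p] by simp
  also have "\<dots> = L_det r v f"
    unfolding L_det_add[symmetric] by (simp add: g_def)
  finally show ?thesis .
qed

section \<open>Label changes along a sequence of points\<close>

definition breaks :: "(nat \<Rightarrow> 'a) \<Rightarrow> nat \<Rightarrow> nat" where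
  "breaks a m = card {i. i < m \<and> a i \<noteq> a (Suc i)}"

lemma breaks_0 [simp]: "breaks a 0 = 0"
  by (simp add: breaks_def)

lemma breaks_Suc: "breaks a (Suc m) = breaks a m + (if a m = a (Suc m) then 0 else 1)"
proof -
  have "{i. i < Suc m \<and> a i \<noteq> a (Suc i)} =
      (if a m = a (Suc m) then {} else {m}) \<union> {i. i < m \<and> a i \<noteq> a (Suc i)}"
    by (auto simp: less_Suc_eq)
  then show ?thesis by (simp add: breaks_def)
qed

text \<open>By \<open>conv\<close> each label occupies one contiguous run. The break indices
  together with \<open>m\<close> are the ends of these runs, so their labels are distinct.\<close>

lemma breaks_less_card:
  assumes fin: "finite P" and lab: "\<And>i. i \<le> m \<Longrightarrow> a i \<in> P"
    and conv: "\<And>i j l. i \<le> j \<Longrightarrow> j \<le> l \<Longrightarrow> l \<le> m \<Longrightarrow> a i = a l \<Longrightarrow> a j = a i"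
  shows "breaks a m < card P"
proof -
  let ?S = "{i. i < m \<and> a i \<noteq> a (Suc i)}"
  have neq: "a i \<noteq> a j" if "i \<in> ?S" "i < j" "j \<le> m" for i j
    using conv[of i "Suc i" j] that by fastforce
  have "inj_on a (insert m ?S)"
  proof (rule linorder_inj_onI')
    fix i j assume "i \<in> insert m ?S" "j \<in> insert m ?S" "i < j"
    then have "i \<in> ?S" "j \<le> m" by auto
    then show "a i \<noteq> a j" using neq \<open>i < j\<close> by blast
  qed
  then have "card (insert m ?S) \<le> card P"
  proof (rule card_inj_on_le[OF _ _ fin])
    show "a ` insert m ?S \<subseteq> P" using lab by (blast intro: less_imp_le)
  qed
  moreover have "card (insert m ?S) = Suc (card ?S)"
    by (rule card_insert_disjoint) simp_all
  ultimately show ?thesis unfolding breaks_def by linarith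
qed

text \<open>Later \<open>a i\<close> and \<open>b i\<close> are the pieces of \<open>f\<close> and
  of \<open>f0\<close> containing the \<open>i\<close>-th point, so a block is a run of points in
  one common piece.\<close>

definition constant_block :: "(nat \<Rightarrow> 'a) \<Rightarrow> (nat \<Rightarrow> 'b) \<Rightarrow> nat \<Rightarrow> nat \<Rightarrow> bool" where
  "constant_block a b l m \<longleftrightarrow> l \<le> m \<and> (\<forall>i\<in>{l..m}. a i = a m \<and> b i = b m)"

lemma constant_block_Suc:
  "constant_block a b l m \<Longrightarrow> a (Suc m) = a m \<Longrightarrow> b (Suc m) = b m \<Longrightarrow>
    constant_block a b l (Suc m)"
  unfolding constant_block_def by (metis atLeastAtMost_iff le_Suc_eq)

lemma constant_blockD:
  assumes "constant_block a b l m" "l \<le> i" "i \<le> m"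
  shows "a i = a m" "b i = b m"
  using assms unfolding constant_block_def by (meson atLeastAtMost_iff)+

lemma constant_block_mono:
  "constant_block a b l m \<Longrightarrow> l \<le> l' \<Longrightarrow> l' \<le> m \<Longrightarrow> constant_block a b l' m"
  unfolding constant_block_def by (meson atLeastAtMost_iff order_trans)

lemma sign_constant_block:
  fixes s :: "nat \<Rightarrow> real"
  assumes same: "\<And>i. b (Suc i) = b i \<Longrightarrow> s (Suc i) = - s i"
    and blk: "constant_block a b l m"
  shows "l + d \<le> m \<Longrightarrow> s (l + d) = (-1) ^ d * s l"
proof (induction d)
  case (Suc d)
  have "b (Suc (l + d)) = b (l + d)"
    using constant_blockD(2)[OF blk, of "l + d"] constant_blockD(2)[OF blk, of "Suc (l + d)"]
      Suc.prems by simp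
  then show ?case using same Suc by simp
qed simp

text \<open>
  Induction on the last index \<open>m\<close>, with \<open>l\<close> the start of a constant block ending at
  \<open>m\<close>: the number \<open>l\<close> of points before it is at most
  \<open>Q m = (r + 1) * breaks a m + r * breaks b m\<close>, or exceeds this by one. In the second case
  the \<open>a\<close>-piece already contains a full block of \<open>r + 1\<close> points with final sign
  opposite to the one that the current block would have if it became full, so it never does.
\<close>

lemma breaks_bound:
  fixes s :: "nat \<Rightarrow> real"
  assumes r: "r \<ge> 1"
    and s0: "\<And>i. s i \<noteq> 0"
    and same: "\<And>i. b (Suc i) = b i \<Longrightarrow> s (Suc i) = - s i"
    and diff: "\<And>i. b (Suc i) \<noteq> b i \<Longrightarrow> s (Suc i) = - ((-1) ^ r) * s i"
    and blocks: "\<And>i j. i + r \<le> n \<Longrightarrow> j + r \<le> n \<Longrightarrow> constant_block a b i (i + r) \<Longrightarrow>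
        constant_block a b j (j + r) \<Longrightarrow> a (i + r) = a (j + r) \<Longrightarrow> s (i + r) = s (j + r)"
  shows "n \<le> (r + 1) * breaks a n + r * breaks b n + r"
proof -
  define Q where "Q m = (r + 1) * breaks a m + r * breaks b m" for m
  \<comment> \<open>Here \<open>(-1) ^ r * s l\<close> is the sign at index \<open>l + r\<close>,
    should the block starting at \<open>l\<close> reach it.\<close>
  define crit where "crit l m \<longleftrightarrow> (\<exists>i. i + r \<le> m \<and> constant_block a b i (i + r) \<and>
      a (i + r) = a m \<and> (-1) ^ r * s l = - s (i + r))" for l m
  have "\<exists>l. constant_block a b l m \<and> m \<le> l + r \<and>
      (l \<le> Q m \<or> l = Suc (Q m) \<and> m < l + r \<and> crit l m)" if "m \<le> n" for m
    using that
  proof (induction m)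
    case 0
    show ?case by (intro exI[of _ 0]) (simp add: constant_block_def)
  next
    case (Suc m)
    then obtain l where l: "constant_block a b l m" "m \<le> l + r"
      and cases: "l \<le> Q m \<or> l = Suc (Q m) \<and> m < l + r \<and> crit l m"
      by auto
    have lm: "l \<le> m" using l by (simp add: constant_block_def)
    show ?case
    proof (cases "a (Suc m) = a m \<and> b (Suc m) = b m")
      case True
      then have blk: "constant_block a b l (Suc m)" using l constant_block_Suc by metis
      have QS: "Q (Suc m) = Q m" using True by (simp add: Q_def breaks_Suc)
      \<comment> \<open>Otherwise the full blocks starting at \<open>l\<close> and at
        \<open>Suc l\<close> would end with opposite signs.\<close>
      have "m \<noteq> l + r"
      proof
        assume m: "m = l + r"
        have "constant_block a b (Suc l) (Suc l + r)"
          using constant_block_mono[OF blk, of "Suc l"] m by simp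
        then have "s m = s (Suc m)"
          using blocks[of l "Suc l"] l m Suc.prems True by simp
        then show False using same[of m] True s0[of m] by simp
      qed
      then have le: "Suc m \<le> l + r" using l by simp
      show ?thesis
      proof (cases "l \<le> Q m")
        case True
        then show ?thesis using blk le QS by auto
      next
        case False
        with cases have lQ: "l = Suc (Q m)" and "crit l m" by auto
        then obtain i where i: "i + r \<le> m" "constant_block a b i (i + r)"
          "a (i + r) = a m" "(-1) ^ r * s l = - s (i + r)"
          by (auto simp: crit_def)
        have "Suc m \<noteq> l + r"
        proof
          assume m: "Suc m = l + r"
          have "s (i + r) = s (l + r)"
            using blocks[of i l] i blk m Suc.prems True by simp
          moreover have "s (l + r) = (-1) ^ r * s l"
            using sign_constant_block[of b s, OF same blk] m by simp
          ultimately show False using i s0[of "i + r"] by simp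
        qed
        then have "Suc m < l + r" using le by simp
        moreover have "crit l (Suc m)"
          using i True unfolding crit_def by (intro exI[of _ i]) simp
        ultimately show ?thesis using blk lQ QS by (intro exI[of _ l]) simp
      qed
    next
      case False
      have blk: "constant_block a b (Suc m) (Suc m)" by (simp add: constant_block_def)
      have mQ: "m \<le> Q m + r" using l cases by auto
      show ?thesis
      proof (cases "Suc m \<le> Q (Suc m)")
        case True
        then show ?thesis using blk by (intro exI[of _ "Suc m"]) simp
      next
        case nle: False
        \<comment> \<open>A break of \<open>a\<close> raises \<open>Q\<close> by at least
          \<open>r + 1\<close>, which with \<open>mQ\<close> would give
          \<open>Suc m \<le> Q (Suc m)\<close>. So only \<open>b\<close> breaks, and the excess is
          exactly one.\<close>
        have aeq: "a (Suc m) = a m"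
          using nle mQ by (auto simp: Q_def breaks_Suc split: if_splits)
        with False have bneq: "b (Suc m) \<noteq> b m" by simp
        have QS: "Q (Suc m) = Q m + r" using aeq bneq by (simp add: Q_def breaks_Suc)
        have m: "m = Q m + r" using nle QS mQ by simp
        \<comment> \<open>The factor in \<open>diff\<close> is chosen for this: a full block
          starting at \<open>Suc m\<close> would end with the sign opposite to
          \<open>s m\<close>.\<close>
        have sgn: "(-1) ^ r * s (Suc m) = - s m"
          using diff[OF bneq] by (simp flip: power_add mult_2)
        have "crit (Suc m) (Suc m)"
        proof (cases "l \<le> Q m")
          case True
          \<comment> \<open>The block that has just ended is full and serves as the witness.\<close>
          then have "m = l + r" using l m by simp
          then show ?thesis
            unfolding crit_def using l sgn aeq by (intro exI[of _ l]) simp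
        next
          case False
          with cases have lQ: "l = Suc (Q m)" and "crit l m" by auto
          then obtain i where i: "i + r \<le> m" "constant_block a b i (i + r)"
            "a (i + r) = a m" "(-1) ^ r * s l = - s (i + r)"
            by (auto simp: crit_def)
          \<comment> \<open>The block that has just ended is one point short of full. Its last sign
            equals that of the old witness, which therefore still serves.\<close>
          have "m = l + (r - 1)" using m lQ r by simp
          then have "s m = (-1) ^ (r - 1) * s l"
            using sign_constant_block[of b s, OF same l(1), of "r - 1"] by simp
          then have "- s m = (-1) ^ r * s l"
            using r by (cases r) auto
          then show ?thesis
            unfolding crit_def using i sgn aeq by (intro exI[of _ i]) simp
        qed
        then show ?thesis using blk m QS r by (intro exI[of _ "Suc m"]) simp
      qed
    qed
  qed
  from this[of n] show ?thesis by (auto simp: Q_def)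
qed

section \<open>From a shattered set to the bound on its size\<close>

lemma shattered_obtain:
  assumes "finite B" "2 ^ card B \<le> card {B \<inter> A | A. A \<in> \<A>}" "S \<subseteq> B"
  obtains A where "A \<in> \<A>" "B \<inter> A = S"
proof -
  have "{B \<inter> A | A. A \<in> \<A>} = Pow B"
    using assms by (intro card_seteq) (auto simp: card_Pow)
  then have "S \<in> {B \<inter> A | A. A \<in> \<A>}" using assms(3) by simp
  then show thesis using that by blast
qed

text \<open>Disjoint intervals meet an increasing sequence in contiguous runs, so
  \<open>breaks_less_card\<close> applies.\<close>

lemma interval_partition_labels:
  assumes P: "interval_partition X k P"
    and x: "strict_mono_on {..m} x" "\<And>i. i \<le> m \<Longrightarrow> x i \<in> X"
  obtains a where "\<And>i. i \<le> m \<Longrightarrow> a i \<in> P" "\<And>i. i \<le> m \<Longrightarrow> x i \<in> a i" "breaks a m < k"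
proof -
  have part: "partition_on X P" and fin: "finite P" and card: "card P \<le> k"
    and int: "\<And>I. I \<in> P \<Longrightarrow> is_interval I"
    using P by (auto simp: interval_partition_def nontrivial_interval_def)
  have "\<forall>i. \<exists>I. i \<le> m \<longrightarrow> I \<in> P \<and> x i \<in> I"
    using x(2) partition_onD1[OF part] by blast
  then obtain a where a: "\<And>i. i \<le> m \<Longrightarrow> a i \<in> P" "\<And>i. i \<le> m \<Longrightarrow> x i \<in> a i"
    by metis
  have uniq: "a i = I" if "i \<le> m" "I \<in> P" "x i \<in> I" for i I
    using partition_onD2[OF part] a[OF that(1)] that by (auto simp: disjoint_def)
  have "a j = a i" if "i \<le> j" "j \<le> l" "l \<le> m" "a i = a l" for i j l
  proof -
    have "x i \<le> x j" "x j \<le> x l"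
      using strict_mono_on_leD[OF x(1)] that by auto
    moreover have "x i \<in> a i" "x l \<in> a i" "is_interval (a i)"
      using a[of i] a[of l] int that by auto
    ultimately have "x j \<in> a i"
      unfolding is_interval_1 by blast
    then show ?thesis using uniq[of j "a i"] a(1)[of i] that by simp
  qed
  then have "breaks a m < card P"
    using fin a(1) by (intro breaks_less_card) blast+
  then have "breaks a m < k" using card by simp
  with a show thesis by (rule that)
qed

lemma VC_dim_le_greater:
  assumes r: "r \<ge> 1"
    and F: "F \<subseteq> piecewise_r_monotone X r k"
    and f0: "piecewise_polynomial X (r - 1) K f0"
  shows "VC_dim_le X {{x \<in> X. f x > f0 x} | f. f \<in> F} ((r + 1) * k + r * (K - 1))"
  unfolding VC_dim_le_def
proof (intro allI impI, elim conjE, rule ccontr)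
  fix B :: "real set"
  let ?\<A> = "{{x \<in> X. f x > f0 x} | f. f \<in> F}"
  assume B: "finite B" "B \<subseteq> X" and large: "(r + 1) * k + r * (K - 1) < card B"
    and "\<not> card {B \<inter> A | A. A \<in> ?\<A>} < 2 ^ card B"
  then have shat: "2 ^ card B \<le> card {B \<inter> A | A. A \<in> ?\<A>}" by simp
  obtain n where n: "card B = Suc n" using large by (cases "card B") auto
  define x where "x i = sorted_list_of_set B ! i" for i
  have len: "length (sorted_list_of_set B) = Suc n" using n by simp
  have mono: "strict_mono_on {..n} x"
    using sorted_wrt_nth_less[OF strict_sorted_list_of_set[of B]] len
    by (auto simp: strict_mono_on_def x_def)
  have xB: "x i \<in> B" if "i \<le> n" for i
    using nth_mem[of i "sorted_list_of_set B"] len that B(1) by (simp add: x_def)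
  have xX: "x i \<in> X" if "i \<le> n" for i
    using xB[OF that] B(2) by auto
  obtain R where R: "interval_partition X K R"
    and poly: "\<And>J. J \<in> R \<Longrightarrow> \<exists>p. degree p \<le> r - 1 \<and> (\<forall>x\<in>J. f0 x = poly p x)"
    using f0 by (auto simp: piecewise_polynomial_def)
  obtain b where b: "\<And>i. i \<le> n \<Longrightarrow> b i \<in> R" "\<And>i. i \<le> n \<Longrightarrow> x i \<in> b i" "breaks b n < K"
    using interval_partition_labels[OF R mono xX] by blast
  \<comment> \<open>The sign flips at each step and picks up a further factor
    \<open>(-1) ^ r\<close> at each break of \<open>b\<close>.\<close>
  define s :: "nat \<Rightarrow> real" where "s i = (-1) ^ (i + r * breaks b i)" for i
  have s_cases: "s i \<in> {1, -1}" for i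
    unfolding s_def by (cases "even (i + r * breaks b i)") auto
  have same: "s (Suc i) = - s i" if "b (Suc i) = b i" for i
    using that by (simp add: s_def breaks_Suc)
  have diff: "s (Suc i) = - ((-1) ^ r) * s i" if "b (Suc i) \<noteq> b i" for i
    using that by (simp add: s_def breaks_Suc power_add)
  have sub: "x ` {i. i \<le> n \<and> s i = 1} \<subseteq> B" using xB by auto
  obtain A where A: "A \<in> ?\<A>" "B \<inter> A = x ` {i. i \<le> n \<and> s i = 1}"
    by (rule shattered_obtain[OF B(1) shat sub])
  then obtain f where f: "f \<in> F" "A = {x \<in> X. f x > f0 x}" by auto
  have inj: "inj_on x {..n}" using mono by (rule strict_mono_on_imp_inj_on)
  have pattern: "f (x i) > f0 (x i) \<longleftrightarrow> s i = 1" if "i \<le> n" for i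
  proof -
    have "f (x i) > f0 (x i) \<longleftrightarrow> x i \<in> B \<inter> A"
      using xB[OF that] xX[OF that] unfolding f(2) by simp
    also have "\<dots> \<longleftrightarrow> s i = 1"
      unfolding A(2) using inj_on_image_mem_iff[OF inj, of i] that by blast
    finally show ?thesis .
  qed
  obtain P where P: "interval_partition X k P" and rmono: "\<And>I. I \<in> P \<Longrightarrow> r_monotone_on r I f"
    using F f(1) by (auto simp: piecewise_r_monotone_def)
  obtain a where a: "\<And>i. i \<le> n \<Longrightarrow> a i \<in> P" "\<And>i. i \<le> n \<Longrightarrow> x i \<in> a i" "breaks a n < k"
    using interval_partition_labels[OF P mono xX] by blast
  \<comment> \<open>On a full block \<open>f0\<close> is a single polynomial and \<open>s\<close>
    alternates, so the last sign \<open>s (i + r)\<close> is the sign of \<open>L_det\<close>.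
    Monotonicity of \<open>f\<close> on its piece then forces equal last signs for all full blocks
    there.\<close>
  have L: "s (i + r) * L_det r (\<lambda>d. x (i + d)) f > 0"
    "\<forall>d\<le>r. x (i + d) \<in> a (i + r)" "strict_mono_on {..r} (\<lambda>d. x (i + d))"
    if i: "i + r \<le> n" "constant_block a b i (i + r)" for i
  proof -
    have lab: "a (i + d) = a (i + r)" "b (i + d) = b (i + r)" if "d \<le> r" for d
      using constant_blockD[OF i(2), of "i + d"] that by simp_all
    show sm: "strict_mono_on {..r} (\<lambda>d. x (i + d))"
      using mono i(1) by (auto simp: strict_mono_on_def)
    show "\<forall>d\<le>r. x (i + d) \<in> a (i + r)"
      using a(2) lab i(1) by (metis add_le_cancel_left order_trans)
    obtain p where p: "degree p \<le> r - 1" "\<And>y. y \<in> b (i + r) \<Longrightarrow> f0 y = poly p y"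
      using poly[OF b(1)[OF i(1)]] by blast
    have sr: "s (i + r) = (-1) ^ r * s i"
      using sign_constant_block[of b s, OF same i(2), of r] by simp
    show "s (i + r) * L_det r (\<lambda>d. x (i + d)) f > 0"
    proof (rule L_det_alternating[OF r sm, of p])
      show "degree p < r" using p(1) r by simp
      show "s (i + r) \<in> {1, -1}" by (rule s_cases)
      fix d assume d: "d \<le> r"
      have le: "i + d \<le> n" using d i(1) by simp
      have "(-1) ^ (d + r) * s (i + r) = (-1) ^ d * s i * ((-1) ^ r * (-1) ^ r)"
        by (simp only: sr power_add mult_ac)
      also have "(-1 :: real) ^ r * (-1) ^ r = 1"
        by (simp flip: power_add mult_2)
      finally have "s (i + d) = (-1) ^ (d + r) * s (i + r)"
        using sign_constant_block[of b s, OF same i(2), of d] d by simp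
      moreover have "f0 (x (i + d)) = poly p (x (i + d))"
        using p(2) b(2)[OF le] lab(2)[OF d] by simp
      ultimately show "(f (x (i + d)) > poly p (x (i + d))) = ((-1) ^ (d + r) * s (i + r) = 1)"
        using pattern[OF le] by (simp only:)
    qed
  qed
  have "n \<le> (r + 1) * breaks a n + r * breaks b n + r"
  proof (rule breaks_bound[of r s b n a, OF r _ same diff])
    show "s i \<noteq> 0" for i by (simp add: s_def)
  next
    fix i j
    assume i: "i + r \<le> n" "constant_block a b i (i + r)"
      and j: "j + r \<le> n" "constant_block a b j (j + r)" and eq: "a (i + r) = a (j + r)"
    have "r_monotone_on r (a (i + r)) f" using rmono a(1) i(1) by blast
    then have "L_det r (\<lambda>d. x (i + d)) f \<ge> 0 \<and> L_det r (\<lambda>d. x (j + d)) f \<ge> 0 \<or>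
        L_det r (\<lambda>d. x (i + d)) f \<le> 0 \<and> L_det r (\<lambda>d. x (j + d)) f \<le> 0"
      using L(2,3)[OF i] L(2,3)[OF j] eq
      unfolding r_monotone_on_def r_nonincreasing_on_def r_nondecreasing_on_def L_det_uminus
      by force
    then show "s (i + r) = s (j + r)"
      using L(1)[OF i] L(1)[OF j] s_cases[of "i + r"] s_cases[of "j + r"] by auto
  qed
  \<comment> \<open>The right-hand side is one less than the claimed degree, while \<open>B\<close>
    has \<open>n + 1\<close> points.\<close>
  also have "\<dots> \<le> (r + 1) * (k - 1) + r * (K - 1) + r"
    using a(3) b(3) by (intro add_mono mult_le_mono) auto
  also have "\<dots> < (r + 1) * k + r * (K - 1)"
    using a(3) by (cases k) auto
  finally show False using large n by simp
qed

section \<open>Negation and the sets where \<open>f < f0\<close>\<close>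

lemma piecewise_r_monotone_uminus:
  "f \<in> piecewise_r_monotone X r k \<Longrightarrow> (\<lambda>x. - f x) \<in> piecewise_r_monotone X r k"
  unfolding piecewise_r_monotone_def r_monotone_on_def r_nonincreasing_on_def by auto

lemma piecewise_polynomial_uminus:
  assumes "piecewise_polynomial X d K f"
  shows "piecewise_polynomial X d K (\<lambda>x. - f x)"
proof -
  obtain P where P: "interval_partition X K P"
    and poly: "\<And>I. I \<in> P \<Longrightarrow> \<exists>p. degree p \<le> d \<and> (\<forall>x\<in>I. f x = poly p x)"
    using assms by (auto simp: piecewise_polynomial_def)
  have "\<exists>p. degree p \<le> d \<and> (\<forall>x\<in>I. - f x = poly p x)" if "I \<in> P" for I
    using poly[OF that] by (metis degree_minus poly_minus)
  with P show ?thesis unfolding piecewise_polynomial_def by blast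
qed

theorem theorem3:
  fixes X :: "real set" and r k K :: nat
    and F :: "(real \<Rightarrow> real) set" and f0 :: "real \<Rightarrow> real"
  assumes "nontrivial_interval X"
    and "r \<ge> 1" and "k \<ge> 1" and "K \<ge> 1"
    and "F \<subseteq> piecewise_r_monotone X r k"
    and "f0 \<in> F"
    and "piecewise_polynomial X (r - 1) K f0"
  shows "extremal X F f0 ((r + 1) * k + r * (K - 1))"
proof -
  let ?D = "(r + 1) * k + r * (K - 1)"
  let ?F' = "(\<lambda>f x. - f x) ` F"
  \<comment> \<open>Negating \<open>F\<close> and \<open>f0\<close> turns the lower sets into upper
    ones, and the hypotheses of \<open>VC_dim_le_greater\<close> survive negation.\<close>
  have "{{x \<in> X. f x < f0 x} | f. f \<in> F} = {{x \<in> X. g x > - f0 x} | g. g \<in> ?F'}"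
    by (simp add: Setcompr_eq_image image_image)
  moreover have "VC_dim_le X {{x \<in> X. g x > - f0 x} | g. g \<in> ?F'} ?D"
  proof (rule VC_dim_le_greater[OF assms(2) _ piecewise_polynomial_uminus[OF assms(7)]])
    show "?F' \<subseteq> piecewise_r_monotone X r k"
      using assms(5) piecewise_r_monotone_uminus by blast
  qed
  moreover have "VC_dim_le X {{x \<in> X. f x > f0 x} | f. f \<in> F} ?D"
    using assms(2,5,7) by (rule VC_dim_le_greater)
  ultimately show ?thesis
    using assms(2,3,6) by (simp add: extremal_def)
qed

end
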